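(* For any integer $k_0>1$, there exist integers $a\ge 3$ and $m\ge 1$ such that the function $f(k)=\mu(I_{a,m}^k)$, $k\ge 1$, has a local maximum for $k=k_0$.
   Context: $K$ is a field and $\mu(L)$ denotes the minimal number of generators of a graded ideal $L$. For integers $a\ge 3$ and $m\ge 1$, $I_{a,m}=(x_1^{am},x_2^{am})(x_1^m,x_2^m)+(x_1,x_2)^{(a+2)m-1}\subset K[x_1,x_2]$. A function $f$ on the positive integers has a local maximum for $k=k_0$ (with $k_0>1$) if $f(k_0-1)<f(k_0)>f(k_0+1)$. *)

theory Defs
  imports Complex_Main "HOL-Library.Poly_Mapping" "HOL-Library.Product_Plus" "HOL-Library.Set_Algebras"
begin

text \<open>
  The polynomial ring \<open>K[x\<^sub>1, x\<^sub>2]\<close> is realised as the monoid algebra of \<open>\<nat>\<^sup>2\<close> over \<open>K\<close>: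
  the coefficient of \<open>x\<^sub>1^i * x\<^sub>2^j\<close> in \<open>p\<close> is \<open>lookup p (i, j)\<close>, and multiplication of
  finitely supported functions is convolution.
\<close>

type_synonym 'k poly2 = "(nat \<times> nat) \<Rightarrow>\<^sub>0 'k"

definition X1 :: "'k::field poly2" where
  "X1 = Poly_Mapping.single (1, 0) 1"

definition X2 :: "'k::field poly2" where
  "X2 = Poly_Mapping.single (0, 1) 1"

text \<open>Ideals of a commutative ring are its submodules when it is viewed as a module over itself.\<close>

definition ideal_gen :: "'a::comm_ring_1 set \<Rightarrow> 'a set" where
  "ideal_gen S = module.span (*) S"

lemma module_times: "module ((*) :: 'a::comm_ring_1 \<Rightarrow> 'a \<Rightarrow> 'a)"
  by unfold_locales (simp_all add: algebra_simps)

lemma ideal_gen_explicit: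
  "ideal_gen S = {(\<Sum>s\<in>T. r s * s) | T r. finite T \<and> T \<subseteq> S}"
  unfolding ideal_gen_def by (rule module.span_explicit[OF module_times])

text \<open>
  From \<open>Set_Algebras\<close>, \<open>I * J\<close> is only the set of all products of an element of \<open>I\<close> with an
  element of \<open>J\<close>, so the ideal product is the ideal it generates. The elementwise sum
  \<open>I + J\<close> already is the sum of the ideals.
\<close>

definition ideal_prod :: "'a::comm_ring_1 set \<Rightarrow> 'a set \<Rightarrow> 'a set" where
  "ideal_prod I J = ideal_gen (I * J)"

primrec ideal_pow :: "'a::comm_ring_1 set \<Rightarrow> nat \<Rightarrow> 'a set" where
  "ideal_pow I 0 = UNIV"
| "ideal_pow I (Suc k) = ideal_prod I (ideal_pow I k)"

text \<open>
  Minimal number of generators. All generating sets are admitted, not only homogeneous ones.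
  The value is meaningful only for finitely generated ideals; in \<open>K[x\<^sub>1, x\<^sub>2]\<close> every ideal is.
\<close>

definition min_gens :: "'a::comm_ring_1 set \<Rightarrow> nat" where
  "min_gens L = (LEAST n. \<exists>S. finite S \<and> card S = n \<and> ideal_gen S = L)"

text \<open>For \<open>m \<ge> 1\<close> the truncated subtraction in the last exponent is the integer one.\<close>

definition I_am :: "nat \<Rightarrow> nat \<Rightarrow> 'k::field poly2 set" where
  "I_am a m =
     ideal_prod (ideal_gen {X1 ^ (a * m), X2 ^ (a * m)}) (ideal_gen {X1 ^ m, X2 ^ m})
     + ideal_pow (ideal_gen {X1, X2}) ((a + 2) * m - 1)"

definition has_local_max_at :: "(nat \<Rightarrow> nat) \<Rightarrow> nat \<Rightarrow> bool" where
  "has_local_max_at f k0 \<longleftrightarrow> 1 < k0 \<and> f (k0 - 1) < f k0 \<and> f k0 > f (k0 + 1)"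

end

theory Submission
  imports Defs "HOL-Library.Function_Algebras"
begin

text \<open>
  Write \<open>J = (x\<^sub>1^(a*m), x\<^sub>2^(a*m)) (x\<^sub>1^m, x\<^sub>2^m)\<close>, let \<open>M\<close> be the maximal ideal
  \<open>(x\<^sub>1, x\<^sub>2)\<close>, and let \<open>k < a\<close>. The gaps between the generators of \<open>J^k\<close> are so small that
  multiplying by the summand \<open>M^((a+2)*m-1)\<close> of the ideal fills them, whence
  \<open>I^k = J^k + M^(k*(a+1)*m + m-1)\<close>. The \<open>(k+1)^2\<close> generators of \<open>J^k\<close> each account for exactly
  \<open>m\<close> of the \<open>m*(k*(a+1)+1)\<close> monomials of degree \<open>k*(a+1)*m + m-1\<close>, so
  \<open>\<mu>(I^k) = m*(k*(a+1)+1) - (m-1)*(k+1)^2\<close>. This is a concave quadratic in \<open>k\<close>, and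
  \<open>a = 2*k0+1\<close>, \<open>m = 2*k0+4\<close> put its maximum at \<open>k0\<close>.

  Generating sets need not consist of monomials. The lower bound for \<open>\<mu>\<close> comes from reading off
  the coefficients at the minimal exponents: these vectors span, so every generating set has at
  least as many elements as there are minimal exponents.
\<close>

section \<open>Monomial ideals\<close>

abbreviation monom2 :: "nat \<times> nat \<Rightarrow> 'k::field poly2" where
  "monom2 t \<equiv> Poly_Mapping.single t 1"

text \<open>The set \<open>A\<close> of exponents may be arbitrary; the result is an ideal once
  \<open>A + UNIV = A\<close>. Accordingly \<open>T + UNIV\<close> collects the exponents of all
  monomial multiples of the monomials in \<open>T\<close>.\<close>

definition monomial_ideal :: "(nat \<times> nat) set \<Rightarrow> 'k::field poly2 set" where
  "monomial_ideal A = {p. Poly_Mapping.keys p \<subseteq> A}"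

lemma mem_plus_UNIV_iff:
  "t \<in> A + (UNIV :: (nat \<times> nat) set) \<longleftrightarrow> (\<exists>s\<in>A. fst s \<le> fst t \<and> snd s \<le> snd t)"
proof
  assume "t \<in> A + UNIV"
  then show "\<exists>s\<in>A. fst s \<le> fst t \<and> snd s \<le> snd t"
    by (force elim!: set_plus_elim)
next
  assume "\<exists>s\<in>A. fst s \<le> fst t \<and> snd s \<le> snd t"
  then obtain s where s: "s \<in> A" "fst s \<le> fst t" "snd s \<le> snd t" by blast
  then have "t = s + (fst t - fst s, snd t - snd s)" by (simp add: prod_eq_iff)
  then show "t \<in> A + UNIV" using s(1) by (metis UNIV_I set_plus_intro)
qed

lemma mem_plus_UNIV_self: "t \<in> A \<Longrightarrow> t \<in> A + (UNIV :: (nat \<times> nat) set)"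
  by (auto simp: mem_plus_UNIV_iff intro!: bexI[of _ t])

lemma UNIV_plus_UNIV: "(UNIV :: (nat \<times> nat) set) + UNIV = UNIV"
  by (auto simp: mem_plus_UNIV_iff)

lemma plus_UNIV_idem: "A + (UNIV :: (nat \<times> nat) set) + UNIV = A + UNIV"
  by (simp add: add.assoc UNIV_plus_UNIV)

lemma sum_single_lookup: "(\<Sum>t\<in>Poly_Mapping.keys p. Poly_Mapping.single t (Poly_Mapping.lookup p t)) = p"
  by (rule poly_mapping_eqI) (auto simp: lookup_sum lookup_single when_def in_keys_iff)

lemma subspace_monomial_ideal:
  assumes "A + UNIV = A"
  shows "module.subspace (*) (monomial_ideal A :: 'k::field poly2 set)"
  unfolding module.subspace_def[OF module_times]
proof (intro conjI ballI allI)
  show "0 \<in> (monomial_ideal A :: 'k poly2 set)" by (simp add: monomial_ideal_def)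
next
  fix p q :: "'k poly2"
  assume "p \<in> monomial_ideal A" "q \<in> monomial_ideal A"
  then show "p + q \<in> monomial_ideal A"
    using keys_add[of p q] by (auto simp: monomial_ideal_def)
next
  fix r p :: "'k poly2"
  assume p: "p \<in> monomial_ideal A"
  have "s + t \<in> A" if "t \<in> A" for s t
    using assms that by (metis UNIV_I add.commute set_plus_intro)
  then show "r * p \<in> monomial_ideal A"
    using keys_mult[of r p] p by (fastforce simp: monomial_ideal_def)
qed

text \<open>The polynomials supported on multiples of the generators already form an ideal, and each
  single term of such a polynomial is a multiple of one generator.\<close>

lemma ideal_gen_monomials: "ideal_gen (monom2 ` T) = (monomial_ideal (T + UNIV) :: 'k::field poly2 set)"
  unfolding ideal_gen_def
proof (rule module.span_subspace[OF module_times])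
  show "monom2 ` T \<subseteq> (monomial_ideal (T + UNIV) :: 'k poly2 set)"
    by (auto simp: monomial_ideal_def intro: mem_plus_UNIV_self)
  show "module.subspace (*) (monomial_ideal (T + UNIV) :: 'k poly2 set)"
    by (rule subspace_monomial_ideal) (rule plus_UNIV_idem)
  show "(monomial_ideal (T + UNIV) :: 'k poly2 set) \<subseteq> module.span (*) (monom2 ` T)"
  proof
    fix p :: "'k poly2"
    assume p: "p \<in> monomial_ideal (T + UNIV)"
    have "(\<Sum>t\<in>Poly_Mapping.keys p. Poly_Mapping.single t (Poly_Mapping.lookup p t))
            \<in> module.span (*) (monom2 ` T)"
    proof (rule module.span_sum[OF module_times])
      fix t assume "t \<in> Poly_Mapping.keys p"
      then have "t \<in> T + UNIV" using p by (auto simp: monomial_ideal_def)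
      then obtain s u where s: "s \<in> T" and t: "t = s + u" by (auto elim!: set_plus_elim)
      have "Poly_Mapping.single u (Poly_Mapping.lookup p t) * monom2 s \<in> module.span (*) (monom2 ` T)"
        using s by (intro module.span_scale[OF module_times] module.span_base[OF module_times]) auto
      then show "Poly_Mapping.single t (Poly_Mapping.lookup p t) \<in> module.span (*) (monom2 ` T)"
        by (simp add: mult_single t add.commute)
    qed
    then show "p \<in> module.span (*) (monom2 ` T)" by (simp add: sum_single_lookup)
  qed
qed

text \<open>Keys of a product are sums of keys. Conversely, monomials with exponent in
  \<open>A + B\<close> are products of two monomials, and they generate everything because
  \<open>A + B\<close> inherits upward closure from \<open>B\<close>.\<close>

lemma ideal_prod_monomial_ideal:
  assumes "B + UNIV = B"
  shows "ideal_prod (monomial_ideal A) (monomial_ideal B) = (monomial_ideal (A + B) :: 'k::field poly2 set)"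
proof -
  have up: "A + B + UNIV = A + B" by (simp add: add.assoc assms)
  show ?thesis
  proof
    show "ideal_prod (monomial_ideal A) (monomial_ideal B) \<subseteq> (monomial_ideal (A + B) :: 'k poly2 set)"
      unfolding ideal_prod_def ideal_gen_def
    proof (rule module.span_minimal[OF module_times _ subspace_monomial_ideal[OF up]])
      show "monomial_ideal A * monomial_ideal B \<subseteq> (monomial_ideal (A + B) :: 'k poly2 set)"
      proof
        fix x :: "'k poly2" assume "x \<in> monomial_ideal A * monomial_ideal B"
        then obtain p q where "x = p * q" "Poly_Mapping.keys p \<subseteq> A" "Poly_Mapping.keys q \<subseteq> B"
          by (auto elim!: set_times_elim simp: monomial_ideal_def)
        then show "x \<in> monomial_ideal (A + B)"
          using keys_mult[of p q] unfolding monomial_ideal_def by (blast intro: set_plus_intro)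
      qed
    qed
    have "monom2 ` (A + B) \<subseteq> (monomial_ideal A * monomial_ideal B :: 'k poly2 set)"
    proof
      fix x :: "'k poly2" assume "x \<in> monom2 ` (A + B)"
      then obtain s t where "s \<in> A" "t \<in> B" "x = monom2 s * monom2 t"
        by (auto elim!: set_plus_elim simp: mult_single)
      then show "x \<in> monomial_ideal A * monomial_ideal B"
        by (auto intro!: set_times_intro simp: monomial_ideal_def)
    qed
    then have "ideal_gen (monom2 ` (A + B))
        \<subseteq> (ideal_prod (monomial_ideal A) (monomial_ideal B) :: 'k poly2 set)"
      unfolding ideal_prod_def ideal_gen_def by (rule module.span_mono[OF module_times])
    then show "monomial_ideal (A + B)
        \<subseteq> (ideal_prod (monomial_ideal A) (monomial_ideal B) :: 'k poly2 set)"
      by (simp add: ideal_gen_monomials up)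
  qed
qed

lemma monomial_ideal_plus:
  "monomial_ideal A + monomial_ideal B = (monomial_ideal (A \<union> B) :: 'k::field poly2 set)"
proof
  show "monomial_ideal A + monomial_ideal B \<subseteq> (monomial_ideal (A \<union> B) :: 'k poly2 set)"
  proof
    fix x :: "'k poly2" assume "x \<in> monomial_ideal A + monomial_ideal B"
    then obtain p q where "x = p + q" "Poly_Mapping.keys p \<subseteq> A" "Poly_Mapping.keys q \<subseteq> B"
      by (auto elim!: set_plus_elim simp: monomial_ideal_def)
    then show "x \<in> monomial_ideal (A \<union> B)"
      using keys_add[of p q] by (auto simp: monomial_ideal_def)
  qed
  show "(monomial_ideal (A \<union> B) :: 'k poly2 set) \<subseteq> monomial_ideal A + monomial_ideal B"
  proof
    fix p :: "'k poly2" assume p: "p \<in> monomial_ideal (A \<union> B)"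
    let ?f = "\<lambda>t. Poly_Mapping.single t (Poly_Mapping.lookup p t)" and ?K = "Poly_Mapping.keys p"
    \<comment> \<open>Terms whose exponents lie in both sets go to the first summand.\<close>
    have eq: "p = sum ?f (?K \<inter> A) + sum ?f (?K - A)"
      using sum.Int_Diff[of ?K ?f A] by (simp add: sum_single_lookup)
    have A: "sum ?f (?K \<inter> A) \<in> monomial_ideal A"
      using keys_sum[of ?f "?K \<inter> A"] by (auto simp: monomial_ideal_def split: if_splits)
    have B: "sum ?f (?K - A) \<in> monomial_ideal B"
      using keys_sum[of ?f "?K - A"] p by (fastforce simp: monomial_ideal_def split: if_splits)
    show "p \<in> monomial_ideal A + monomial_ideal B"
      by (subst eq) (rule set_plus_intro[OF A B])
  qed
qed

section \<open>Number of generators\<close>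

text \<open>Only the constant term of \<open>p\<close> can contribute to the coefficient at a minimal exponent.\<close>

lemma lookup_mult_minimal:
  fixes p q :: "'k::field poly2"
  assumes min: "\<And>g h t. g \<in> G \<Longrightarrow> h \<in> G \<Longrightarrow> h = g + t \<Longrightarrow> t = 0"
    and q: "q \<in> monomial_ideal (G + UNIV)" and g: "g \<in> G"
  shows "Poly_Mapping.lookup (p * q) g = Poly_Mapping.lookup p 0 * Poly_Mapping.lookup q g"
proof -
  define c where "c = Poly_Mapping.lookup p 0"
  define p' where "p' = p - Poly_Mapping.single 0 c"
  have p: "p = Poly_Mapping.single 0 c + p'" by (simp add: p'_def)
  have p'0: "0 \<notin> Poly_Mapping.keys p'" by (simp add: p'_def c_def in_keys_iff lookup_minus)
  \<comment> \<open>Such a key would be \<open>h + (l + u)\<close> with \<open>h\<close> in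
    \<open>G\<close> and \<open>l\<close> nonzero, against minimality.\<close>
  have "g \<notin> Poly_Mapping.keys (p' * q)"
  proof
    assume "g \<in> Poly_Mapping.keys (p' * q)"
    then obtain l b where l: "l \<in> Poly_Mapping.keys p'" and b: "b \<in> Poly_Mapping.keys q" and "g = l + b"
      using keys_mult[of p' q] by auto
    moreover obtain h u where h: "h \<in> G" and "b = h + u"
      using q b by (auto simp: monomial_ideal_def elim!: set_plus_elim dest!: subsetD)
    ultimately have "g = h + (l + u)" by (simp add: ac_simps)
    then have "l + u = 0" using min[OF h g] by blast
    then have "l = 0" by (simp add: prod_eq_iff)
    then show False using l p'0 by simp
  qed
  then have "Poly_Mapping.lookup (p' * q) g = 0" by (simp add: in_keys_iff)
  moreover have "Poly_Mapping.lookup (Poly_Mapping.single 0 c * q) g = c * Poly_Mapping.lookup q g"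
    by (simp add: mult_map_scale_conv_mult[symmetric] map.rep_eq when_def)
  ultimately have "Poly_Mapping.lookup ((Poly_Mapping.single 0 c + p') * q) g = c * Poly_Mapping.lookup q g"
    by (simp add: distrib_right lookup_add)
  then show ?thesis unfolding p[symmetric] by (simp only: c_def)
qed

lemma vector_space_fun: "vector_space (\<lambda>(c::'k::field) (f::'b \<Rightarrow> 'k) x. c * f x)"
  by unfold_locales (auto simp: fun_eq_iff algebra_simps)

text \<open>The map \<open>\<phi>\<close> models the quotient of the ideal by its product with the
  maximal ideal: by \<open>lookup_mult_minimal\<close> a multiplier acts through its constant term
  alone. Combinations with polynomial coefficients thus become combinations over the field, so the
  images of \<open>S\<close> span the \<open>card G\<close> unit vectors.\<close>

lemma card_le_generators:
  fixes S :: "'k::field poly2 set"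
  assumes fin: "finite G"
    and min: "\<And>g h t. g \<in> G \<Longrightarrow> h \<in> G \<Longrightarrow> h = g + t \<Longrightarrow> t = 0"
    and S: "finite S" "ideal_gen S = monomial_ideal (G + UNIV)"
  shows "card G \<le> card S"
proof -
  interpret vs: vector_space "\<lambda>(c::'k) (f::nat \<times> nat \<Rightarrow> 'k) x. c * f x"
    by (rule vector_space_fun)
  define e :: "nat \<times> nat \<Rightarrow> nat \<times> nat \<Rightarrow> 'k" where "e g = (\<lambda>x. if x = g then 1 else 0)" for g
  \<comment> \<open>Off \<open>G\<close> the value is set to 0, since only on coefficients in
    \<open>G\<close> do multipliers act as scalars.\<close>
  define \<phi> :: "'k poly2 \<Rightarrow> nat \<times> nat \<Rightarrow> 'k" where "\<phi> p = (\<lambda>x. if x \<in> G then Poly_Mapping.lookup p x else 0)" for p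
  have inj: "inj_on e G"
    by (rule inj_onI) (metis e_def zero_neq_one)
  have sum_apply: "sum F A x = (\<Sum>a\<in>A. F a x)" for F :: "'z \<Rightarrow> nat \<times> nat \<Rightarrow> 'k" and A x
    by (induction A rule: infinite_finite_induct) auto
  have indep: "vs.independent (e ` G)"
  proof (rule vs.independent_if_scalars_zero)
    show "finite (e ` G)" using fin by simp
    fix f :: "(nat \<times> nat \<Rightarrow> 'k) \<Rightarrow> 'k" and v
    assume 0: "(\<Sum>w\<in>e ` G. (\<lambda>x. f w * w x)) = 0" and "v \<in> e ` G"
    then obtain g where g: "g \<in> G" "v = e g" by blast
    have "0 = (\<Sum>w\<in>e ` G. (\<lambda>x. f w * w x)) g" using 0 by simp
    also have "\<dots> = (\<Sum>h\<in>G. f (e h) * e h g)"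
      by (simp add: sum_apply sum.reindex[OF inj])
    also have "\<dots> = f (e g)"
      using fin g by (simp add: e_def if_distrib sum.delta cong: if_cong)
    finally show "f v = 0" using g by simp
  qed
  have "e ` G \<subseteq> vs.span (\<phi> ` S)"
  proof
    fix v assume "v \<in> e ` G"
    then obtain g where g: "g \<in> G" "v = e g" by blast
    have "monom2 g \<in> ideal_gen S"
      using g by (auto simp: S monomial_ideal_def intro: mem_plus_UNIV_self)
    then obtain T r where T: "finite T" "T \<subseteq> S" and eq: "monom2 g = (\<Sum>s\<in>T. r s * s)"
      unfolding ideal_gen_explicit by blast
    have SL: "s \<in> monomial_ideal (G + UNIV)" if "s \<in> S" for s
      using that S(2) module.span_base[OF module_times, of s S] by (simp add: ideal_gen_def)
    have "e g = \<phi> (monom2 g)"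
      using g by (auto simp: e_def \<phi>_def lookup_single when_def fun_eq_iff)
    also have "\<dots> = (\<Sum>s\<in>T. (\<lambda>x. Poly_Mapping.lookup (r s) 0 * \<phi> s x))"
    proof
      fix x
      show "\<phi> (monom2 g) x = (\<Sum>s\<in>T. (\<lambda>x. Poly_Mapping.lookup (r s) 0 * \<phi> s x)) x"
      proof (cases "x \<in> G")
        case True
        have "Poly_Mapping.lookup (r s * s) x = Poly_Mapping.lookup (r s) 0 * Poly_Mapping.lookup s x" if "s \<in> T" for s
        proof (rule lookup_mult_minimal[of G])
          show "s \<in> monomial_ideal (G + UNIV)" using SL that T by blast
        qed (use min True in blast)+
        then show ?thesis using True by (simp add: \<phi>_def eq lookup_sum sum_apply)
      qed (simp add: \<phi>_def sum_apply)
    qed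
    also have "\<dots> \<in> vs.span (\<phi> ` S)"
      using T by (intro vs.span_sum vs.span_scale vs.span_base) auto
    finally show "v \<in> vs.span (\<phi> ` S)" using g by simp
  qed
  then have "card (e ` G) \<le> card (\<phi> ` S)"
    using vs.independent_span_bound[OF _ indep, of "\<phi> ` S"] S by simp
  also have "\<dots> \<le> card S" by (rule card_image_le[OF S(1)])
  finally show ?thesis by (simp add: card_image[OF inj])
qed

lemma min_gens_monomial_ideal:
  assumes "finite G"
    and "\<And>g h t. g \<in> G \<Longrightarrow> h \<in> G \<Longrightarrow> h = g + t \<Longrightarrow> t = 0"
  shows "min_gens (monomial_ideal (G + UNIV) :: 'k::field poly2 set) = card G"
  unfolding min_gens_def
proof (rule Least_equality)
  have "inj_on (monom2 :: _ \<Rightarrow> 'k poly2) G"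
    by (rule inj_onI) (metis lookup_single_eq lookup_single_not_eq zero_neq_one)
  then show "\<exists>S :: 'k poly2 set. finite S \<and> card S = card G \<and> ideal_gen S = monomial_ideal (G + UNIV)"
    using assms(1) by (intro exI[of _ "monom2 ` G"]) (simp add: card_image ideal_gen_monomials)
qed (use card_le_generators assms in blast)

section \<open>The powers of the ideal\<close>

text \<open>These are the exponents of the \<open>d\<close>-th power of the maximal ideal, see
  \<open>maximal_ideal_pow\<close>.\<close>

definition deg_ge :: "nat \<Rightarrow> (nat \<times> nat) set" where
  "deg_ge d = {t. d \<le> fst t + snd t}"

text \<open>The exponents of the generators of \<open>(x\<^sub>1^(a*m), x\<^sub>2^(a*m))^k * (x\<^sub>1^m, x\<^sub>2^m)^k\<close>.\<close>

definition corners :: "nat \<Rightarrow> nat \<Rightarrow> nat \<Rightarrow> (nat \<times> nat) set" where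
  "corners a m k = (\<lambda>(i, l). (m * (a * i + l), m * (a * (k - i) + (k - l)))) ` ({..k} \<times> {..k})"

text \<open>The candidate for the exponents of the \<open>k\<close>-th power, confirmed for
  \<open>k \<le> a\<close> in \<open>ideal_pow_I_am\<close>. The threshold lies \<open>m - 1\<close>
  above the degree of the corners; for \<open>k = 1\<close> it is
  \<open>(a + 2) * m - 1\<close>.\<close>

definition pow_exps :: "nat \<Rightarrow> nat \<Rightarrow> nat \<Rightarrow> (nat \<times> nat) set" where
  "pow_exps a m k = (corners a m k + UNIV) \<union> deg_ge (m * (k * (a + 1) + 1) - 1)"

lemma mem_corners:
  "i \<le> k \<Longrightarrow> l \<le> k \<Longrightarrow> (m * (a * i + l), m * (a * (k - i) + (k - l))) \<in> corners a m k"
  unfolding corners_def by (rule image_eqI[of _ _ "(i, l)"]) auto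

lemma deg_ge_plus_UNIV: "deg_ge d + UNIV = deg_ge d"
proof
  show "deg_ge d + UNIV \<subseteq> deg_ge d"
    by (auto simp: deg_ge_def elim!: set_plus_elim)
qed (auto intro: mem_plus_UNIV_self)

lemma deg_ge_plus: "deg_ge c + deg_ge d = deg_ge (c + d)"
proof
  show "deg_ge c + deg_ge d \<subseteq> deg_ge (c + d)"
    by (auto simp: deg_ge_def elim!: set_plus_elim)
  show "deg_ge (c + d) \<subseteq> deg_ge c + deg_ge d"
  proof
    fix t assume "t \<in> deg_ge (c + d)"
    then have t: "c + d \<le> fst t + snd t" by (simp add: deg_ge_def)
    \<comment> \<open>A divisor of degree exactly \<open>c\<close> that takes as much as possible
      from the first variable.\<close>
    let ?s = "(min (fst t) c, c - min (fst t) c)"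
    have "t = ?s + (fst t - fst ?s, snd t - snd ?s)" using t by (auto simp: prod_eq_iff)
    moreover have "?s \<in> deg_ge c" "(fst t - fst ?s, snd t - snd ?s) \<in> deg_ge d"
      using t by (auto simp: deg_ge_def)
    ultimately show "t \<in> deg_ge c + deg_ge d" by (metis set_plus_intro)
  qed
qed

lemma pow_exps_plus_UNIV: "pow_exps a m k + UNIV = pow_exps a m k"
  by (simp add: pow_exps_def Un_set_plus plus_UNIV_idem deg_ge_plus_UNIV)

lemma corners_degree:
  assumes "t \<in> corners a m k"
  shows "fst t + snd t = m * (k * (a + 1))"
proof -
  obtain i l where "i \<le> k" "l \<le> k" and t: "t = (m * (a * i + l), m * (a * (k - i) + (k - l)))"
    using assms by (auto simp: corners_def)
  then obtain p q where pq: "k = i + p" "k = l + q" by (metis le_add_diff_inverse)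
  then have "k - i = p" "k - l = q" by (metis add_diff_cancel_left')+
  then have "fst t + snd t = m * (a * (i + p) + (l + q))" by (simp add: t algebra_simps)
  also have "\<dots> = m * (k * (a + 1))" unfolding pq[symmetric] by (simp add: algebra_simps)
  finally show ?thesis .
qed

text \<open>On exponents of generators this is \<open>J^j * J^k = J^(j+k)\<close>: the indices
  \<open>i\<close> and \<open>l\<close> add up, and they can be split independently of each
  other.\<close>

lemma corners_plus: "corners a m j + corners a m k = corners a m (j + k)"
proof
  show "corners a m j + corners a m k \<subseteq> corners a m (j + k)"
  proof
    fix t assume "t \<in> corners a m j + corners a m k"
    then obtain i l i' l' where le: "i \<le> j" "l \<le> j" "i' \<le> k" "l' \<le> k" and
      t: "t = (m * (a * i + l), m * (a * (j - i) + (j - l))) + (m * (a * i' + l'), m * (a * (k - i') + (k - l')))"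
      by (auto simp: corners_def elim!: set_plus_elim)
    have "(j + k) - (i + i') = (j - i) + (k - i')" "(j + k) - (l + l') = (j - l) + (k - l')"
      using le by auto
    then have "t = (m * (a * (i + i') + (l + l')), m * (a * ((j + k) - (i + i')) + ((j + k) - (l + l'))))"
      by (simp only: t) (simp add: algebra_simps)
    then show "t \<in> corners a m (j + k)" using mem_corners[of "i + i'" "j + k" "l + l'"] le by simp
  qed
  show "corners a m (j + k) \<subseteq> corners a m j + corners a m k"
  proof
    fix t assume "t \<in> corners a m (j + k)"
    then obtain i l where le: "i \<le> j + k" "l \<le> j + k" and
      t: "t = (m * (a * i + l), m * (a * (j + k - i) + (j + k - l)))"
      by (auto simp: corners_def)
    define i1 l1 where "i1 = min i j" and "l1 = min l j"
    define i2 l2 where "i2 = i - i1" and "l2 = l - l1"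
    have le': "i1 \<le> j" "l1 \<le> j" "i2 \<le> k" "l2 \<le> k" and
      eqs: "i = i1 + i2" "l = l1 + l2" "j + k - i = (j - i1) + (k - i2)" "j + k - l = (j - l1) + (k - l2)"
      using le by (auto simp: i1_def l1_def i2_def l2_def)
    have "t = (m * (a * i1 + l1), m * (a * (j - i1) + (j - l1))) + (m * (a * i2 + l2), m * (a * (k - i2) + (k - l2)))"
      unfolding t eqs(3,4) by (simp add: eqs(1,2) algebra_simps)
    moreover have "(m * (a * i1 + l1), m * (a * (j - i1) + (j - l1))) \<in> corners a m j"
      "(m * (a * i2 + l2), m * (a * (k - i2) + (k - l2))) \<in> corners a m k"
      using le' by (simp_all only: mem_corners)
    ultimately show "t \<in> corners a m j + corners a m k" by (metis set_plus_intro)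
  qed
qed

text \<open>
  Consecutive corners are at most \<open>a * m\<close> apart, so every monomial of large degree is a multiple
  of one of them.
\<close>

lemma corner_below:
  assumes m: "m \<ge> 1" and k: "k < a" and deg: "m * (k * (a + 1) + (a + 2)) - 1 \<le> x + y"
  shows "\<exists>s\<in>corners a m k. fst s \<le> x \<and> snd s \<le> y"
proof (cases "m * (k * (a + 1)) \<le> x")
  case True
  \<comment> \<open>The corner \<open>i = l = k\<close> is a pure power of
    \<open>X1\<close>.\<close>
  have "(m * (a * k + k), m * (a * (k - k) + (k - k))) \<in> corners a m k"
    by (simp only: mem_corners le_refl)
  then show ?thesis using True by (intro bexI) (auto simp: algebra_simps)
next
  case False
  \<comment> \<open>Here corners with \<open>l = 0\<close> suffice; \<open>c\<close> indexes the
    last one whose first coordinate is at most \<open>x\<close>.\<close>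
  define c where "c = x div (m * a)"
  have ma: "m * a > 0" using m k by simp
  have c1: "m * a * c \<le> x" and c2: "x < m * a * (c + 1)"
    using div_times_less_eq_dividend[of x "m * a"] dividend_less_times_div[OF ma, of x]
    by (auto simp: c_def mult.commute)
  \<comment> \<open>This is where \<open>k < a\<close> enters, through
    \<open>k * (a + 1) \<le> a * (k + 1)\<close>.\<close>
  have "c \<le> k"
  proof (rule ccontr)
    assume "\<not> c \<le> k"
    then have "m * a * (k + 1) \<le> m * a * c" by (intro mult_left_mono) auto
    moreover have "m * (k * (a + 1)) \<le> m * a * (k + 1)"
      using k by (simp add: algebra_simps)
    ultimately show False using c1 False by linarith
  qed
  then obtain p where p: "k = c + p" using le_Suc_ex by blast
  \<comment> \<open>Since \<open>x < m * a * (c + 1)\<close>, the degree bound leaves enough for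
    \<open>y\<close>.\<close>
  have "m * (a * p + k) \<le> y"
  proof -
    have "m * (k * (a + 1) + (a + 2)) = m * a * (c + 1) + m * (a * p + k) + 2 * m"
      by (simp add: p algebra_simps)
    then show ?thesis using c2 deg m by linarith
  qed
  moreover have "(m * (a * c + 0), m * (a * (k - c) + (k - 0))) \<in> corners a m k"
    using \<open>c \<le> k\<close> by (intro mem_corners) auto
  ultimately show ?thesis using c1 p by (intro bexI) (auto simp: algebra_simps)
qed

text \<open>Corners add to corners, and every sum that involves a \<open>deg_ge\<close> part reaches
  the new threshold. Conversely, an exponent beyond the new threshold lies above some corner for
  \<open>k\<close> by \<open>corner_below\<close>, and the difference has degree at least the
  threshold for \<open>1\<close>.\<close>

lemma pow_exps_Suc:
  assumes m: "m \<ge> 1" and k: "k < a"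
  shows "pow_exps a m 1 + pow_exps a m k = pow_exps a m (Suc k)"
proof
  let ?D = "\<lambda>k. m * (k * (a + 1) + 1) - 1"
  have sub: "pow_exps a m j \<subseteq> deg_ge (m * (j * (a + 1)))" for j
  proof
    fix t assume "t \<in> pow_exps a m j"
    then show "t \<in> deg_ge (m * (j * (a + 1)))"
      unfolding pow_exps_def
    proof
      assume "t \<in> corners a m j + UNIV"
      then obtain s where "s \<in> corners a m j" "fst s \<le> fst t" "snd s \<le> snd t"
        by (auto simp: mem_plus_UNIV_iff)
      then show ?thesis using corners_degree[of s a m j] by (simp add: deg_ge_def)
    next
      assume "t \<in> deg_ge (?D j)"
      then show ?thesis using m by (auto simp: deg_ge_def)
    qed
  qed
  have deg_le: "deg_ge c \<subseteq> pow_exps a m (Suc k)" if "?D (Suc k) \<le> c" for c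
    using that by (auto simp: pow_exps_def deg_ge_def)
  have cc: "(corners a m 1 + UNIV) + (corners a m k + UNIV) = corners a m (Suc k) + UNIV"
    by (metis (no_types, opaque_lifting) add.assoc add.commute corners_plus UNIV_plus_UNIV plus_1_eq_Suc)
  \<comment> \<open>\<open>D1\<close> serves corner multiples plus the \<open>deg_ge\<close> part
    for \<open>k\<close>, \<open>D2\<close> the \<open>deg_ge\<close> part for \<open>1\<close> plus
    anything. Both bounds are equalities because \<open>m \<ge> 1\<close> keeps the subtraction from
    truncating.\<close>
  have D1: "?D (Suc k) \<le> m * (1 * (a + 1)) + ?D k" and D2: "?D (Suc k) \<le> ?D 1 + m * (k * (a + 1))"
    using m by (simp_all add: algebra_simps)
  have "(corners a m 1 + UNIV) + deg_ge (?D k) \<subseteq> deg_ge (m * (1 * (a + 1))) + deg_ge (?D k)"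
    using sub[of 1] by (intro set_plus_mono2) (auto simp: pow_exps_def)
  moreover have "deg_ge (?D 1) + pow_exps a m k \<subseteq> deg_ge (?D 1) + deg_ge (m * (k * (a + 1)))"
    using sub[of k] by (intro set_plus_mono2) auto
  moreover have "pow_exps a m 1 + pow_exps a m k =
      (corners a m 1 + UNIV) + (corners a m k + UNIV) \<union> ((corners a m 1 + UNIV) + deg_ge (?D k))
      \<union> (deg_ge (?D 1) + pow_exps a m k)"
    unfolding pow_exps_def by (simp only: Un_set_plus set_plus_Un Un_ac)
  ultimately show "pow_exps a m 1 + pow_exps a m k \<subseteq> pow_exps a m (Suc k)"
    using deg_le[OF D1] deg_le[OF D2] unfolding deg_ge_plus cc by (auto simp: pow_exps_def)
  show "pow_exps a m (Suc k) \<subseteq> pow_exps a m 1 + pow_exps a m k"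
  proof
    fix t assume "t \<in> pow_exps a m (Suc k)"
    then show "t \<in> pow_exps a m 1 + pow_exps a m k"
      unfolding pow_exps_def[of a m "Suc k"]
    proof
      assume "t \<in> corners a m (Suc k) + UNIV"
      then show ?thesis unfolding cc[symmetric]
        using set_plus_mono2[of "corners a m 1 + UNIV" "pow_exps a m 1" "corners a m k + UNIV" "pow_exps a m k"]
        by (auto simp: pow_exps_def)
    next
      assume "t \<in> deg_ge (?D (Suc k))"
      then have deg: "m * (k * (a + 1) + (a + 2)) - 1 \<le> fst t + snd t"
        by (simp add: deg_ge_def algebra_simps)
      obtain s where s: "s \<in> corners a m k" "fst s \<le> fst t" "snd s \<le> snd t"
        using corner_below[OF m k deg] by blast
      let ?u = "(fst t - fst s, snd t - snd s)"
      have t: "t = ?u + s" using s by (simp add: prod_eq_iff)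
      have "?D 1 \<le> fst ?u + snd ?u"
        using corners_degree[OF s(1)] deg s(2,3) by (simp add: algebra_simps)
      then have "?u \<in> pow_exps a m 1" by (simp add: pow_exps_def deg_ge_def)
      moreover have "s \<in> pow_exps a m k"
        using s(1) by (auto simp: pow_exps_def intro: mem_plus_UNIV_self)
      ultimately show ?thesis by (metis t set_plus_intro)
    qed
  qed
qed

section \<open>The ideal and its powers in terms of exponents\<close>

lemma X1_power: "X1 ^ n = monom2 (n, 0)"
  by (induction n) (simp_all add: X1_def mult_single flip: zero_prod_def)

lemma X2_power: "X2 ^ n = monom2 (0, n)"
  by (induction n) (simp_all add: X2_def mult_single flip: zero_prod_def)

lemma maximal_ideal_pow:
  "ideal_pow (ideal_gen {X1, X2}) n = (monomial_ideal (deg_ge n) :: 'k::field poly2 set)"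
proof -
  have "ideal_gen {X1, X2} = (ideal_gen (monom2 ` {(1, 0), (0, 1)}) :: 'k poly2 set)"
    by (simp add: X1_def X2_def)
  also have "\<dots> = monomial_ideal (deg_ge 1)"
    unfolding ideal_gen_monomials
    by (rule arg_cong[of _ _ monomial_ideal]) (auto simp: mem_plus_UNIV_iff deg_ge_def)
  finally have gen: "ideal_gen {X1, X2} = (monomial_ideal (deg_ge 1) :: 'k poly2 set)" .
  show ?thesis
  proof (induction n)
    case 0
    show ?case by (simp add: monomial_ideal_def deg_ge_def)
  next
    case (Suc n)
    then show ?case
      by (simp add: gen ideal_prod_monomial_ideal deg_ge_plus_UNIV deg_ge_plus)
  qed
qed

lemma I_am_eq: "(I_am a m :: 'k::field poly2 set) = monomial_ideal (pow_exps a m 1)"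
proof -
  have gen: "ideal_gen {X1 ^ n, X2 ^ n} = (monomial_ideal ({(n, 0), (0, n)} + UNIV) :: 'k poly2 set)" for n
    by (simp add: X1_power X2_power flip: ideal_gen_monomials)
  \<comment> \<open>The four sums are the corners with \<open>i\<close> and \<open>l\<close> in
    \<open>{0, 1}\<close>.\<close>
  have corners: "{(a * m, 0), (0, a * m)} + {(m, 0), (0, m)} = corners a m 1"
    by (auto simp: corners_def set_plus_image atMost_Suc algebra_simps)
  have "ideal_prod (ideal_gen {X1 ^ (a * m), X2 ^ (a * m)}) (ideal_gen {X1 ^ m, X2 ^ m})
      = (monomial_ideal (({(a * m, 0), (0, a * m)} + UNIV) + ({(m, 0), (0, m)} + UNIV)) :: 'k poly2 set)"
    unfolding gen by (rule ideal_prod_monomial_ideal) (rule plus_UNIV_idem)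
  also have "({(a * m, 0), (0, a * m)} + UNIV) + ({(m, 0), (0, m)} + UNIV) = corners a m 1 + UNIV"
    unfolding corners[symmetric]
    by (metis (no_types, opaque_lifting) add.assoc add.commute UNIV_plus_UNIV)
  finally have "I_am a m = (monomial_ideal (corners a m 1 + UNIV \<union> deg_ge ((a + 2) * m - 1)) :: 'k poly2 set)"
    unfolding I_am_def maximal_ideal_pow by (simp only: monomial_ideal_plus)
  moreover have "(a + 2) * m = m * (1 * (a + 1) + 1)" by (simp add: algebra_simps)
  ultimately show ?thesis by (simp only: pow_exps_def)
qed

lemma ideal_pow_I_am:
  assumes "m \<ge> 1" and "k \<le> a"
  shows "ideal_pow (I_am a m) k = (monomial_ideal (pow_exps a m k) :: 'k::field poly2 set)"
  using assms(2)
proof (induction k)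
  case 0
  \<comment> \<open>For \<open>k = 0\<close> the origin is the only corner.\<close>
  have "pow_exps a m 0 = UNIV"
    by (auto simp: pow_exps_def corners_def mem_plus_UNIV_iff)
  then show ?case by (simp add: monomial_ideal_def)
next
  case (Suc k)
  then show ?case
    using pow_exps_Suc[OF assms(1), of k a]
    by (simp add: I_am_eq ideal_prod_monomial_ideal pow_exps_plus_UNIV)
qed

section \<open>Counting\<close>

text \<open>These are the minimal exponents of \<open>pow_exps a m k\<close> for
  \<open>m \<ge> 1\<close>, as the next two lemmas show.\<close>

definition pow_gens :: "nat \<Rightarrow> nat \<Rightarrow> nat \<Rightarrow> (nat \<times> nat) set" where
  "pow_gens a m k = corners a m k \<union>
     {t. fst t + snd t = m * (k * (a + 1) + 1) - 1 \<and> t \<notin> corners a m k + UNIV}"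

lemma pow_gens_plus_UNIV: "pow_gens a m k + UNIV = pow_exps a m k"
proof
  show "pow_gens a m k + UNIV \<subseteq> pow_exps a m k"
  proof -
    have "pow_gens a m k \<subseteq> pow_exps a m k"
      by (auto simp: pow_gens_def pow_exps_def deg_ge_def intro: mem_plus_UNIV_self)
    then have "pow_gens a m k + UNIV \<subseteq> pow_exps a m k + UNIV" by (rule set_plus_mono2) simp
    then show ?thesis by (simp add: pow_exps_plus_UNIV)
  qed
  show "pow_exps a m k \<subseteq> pow_gens a m k + UNIV"
  proof
    fix t assume t: "t \<in> pow_exps a m k"
    show "t \<in> pow_gens a m k + UNIV"
    proof (cases "t \<in> corners a m k + UNIV")
      case True
      then show ?thesis by (auto simp: pow_gens_def Un_set_plus)
    next
      case False
      define D where "D = m * (k * (a + 1) + 1) - 1"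
      \<comment> \<open>Lowering \<open>t\<close> to degree \<open>D\<close> cannot bring it above a
        corner, since that corner would then lie below \<open>t\<close> too.\<close>
      let ?s = "(min (fst t) D, D - min (fst t) D)"
      have le: "fst ?s \<le> fst t" "snd ?s \<le> snd t"
        using t False by (auto simp: pow_exps_def deg_ge_def D_def)
      then have "?s \<notin> corners a m k + UNIV"
        using False unfolding mem_plus_UNIV_iff by (meson le_trans)
      moreover have "fst ?s + snd ?s = D" by simp
      ultimately have "?s \<in> pow_gens a m k" unfolding pow_gens_def D_def by blast
      then show ?thesis using le unfolding mem_plus_UNIV_iff by blast
    qed
  qed
qed

text \<open>It suffices that the degree does not grow from \<open>g\<close> to \<open>h\<close>. If
  \<open>g\<close> is a corner, then \<open>h\<close> lies above a corner, so it is one itself and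
  has the same degree; otherwise \<open>g\<close> already has the largest degree that
  occurs.\<close>

lemma pow_gens_minimal:
  assumes m: "m \<ge> 1" and g: "g \<in> pow_gens a m k" and h: "h \<in> pow_gens a m k" and eq: "h = g + t"
  shows "t = 0"
proof -
  have deg: "fst h + snd h = fst g + snd g + (fst t + snd t)" using eq by simp
  have "fst h + snd h \<le> fst g + snd g"
  proof (cases "g \<in> corners a m k")
    case True
    then have "h \<in> corners a m k + UNIV" using eq by blast
    then have "h \<in> corners a m k" using h by (auto simp: pow_gens_def)
    then show ?thesis using True by (simp add: corners_degree)
  next
    case False
    then have "fst g + snd g = m * (k * (a + 1) + 1) - 1" using g by (simp add: pow_gens_def)
    moreover have "fst h + snd h \<le> m * (k * (a + 1) + 1) - 1"
      using h m corners_degree[of h a m k] by (auto simp: pow_gens_def)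
    ultimately show ?thesis by simp
  qed
  then show ?thesis using deg by (simp add: prod_eq_iff)
qed

text \<open>Each quotient in \<open>S\<close> accounts for a block of \<open>m\<close> consecutive
  numbers.\<close>

lemma card_div_mem:
  fixes m :: nat
  assumes "m \<ge> 1"
  shows "card {i. i div m \<in> S} = m * card S"
proof -
  have "bij_betw (\<lambda>(u, r). m * u + r) (S \<times> {..<m}) {i. i div m \<in> S}"
    using assms
    by (intro bij_betw_byWitness[where f' = "\<lambda>i. (i div m, i mod m)"]) auto
  then show ?thesis by (metis bij_betw_same_card card_cartesian_product card_lessThan mult.commute)
qed

text \<open>As \<open>l \<le> k < a\<close>, the indices \<open>i\<close> and \<open>l\<close> are
  quotient and remainder modulo \<open>a\<close>. Hence the \<open>(k + 1)^2\<close> corners are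
  distinct.\<close>

lemma inj_on_two_digits:
  fixes a :: nat
  assumes "k < a"
  shows "inj_on (\<lambda>(i, l). a * i + l) ({..k} \<times> {..k})"
proof (rule inj_on_inverseI)
  fix x assume "x \<in> {..k} \<times> {..k}"
  then show "(\<lambda>n. (n div a, n mod a)) ((\<lambda>(i, l). a * i + l) x) = x"
    using assms by auto
qed

text \<open>Exponents of degree \<open>D\<close> are indexed by their first coordinate
  \<open>i < m * (N + 1)\<close>. The corner belonging to \<open>u\<close> in \<open>S\<close> lies
  below exactly those with \<open>i div m = u\<close>, so the corners remove disjoint blocks of size
  \<open>m\<close>. The equation is additive to avoid truncated subtraction.\<close>

lemma card_pow_gens:
  assumes m: "m \<ge> 1" and k: "k < a"
  shows "finite (pow_gens a m k)"
    and "card (pow_gens a m k) + m * (k + 1)^2 = (k + 1)^2 + m * (k * (a + 1) + 1)"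
proof -
  define N where "N = k * (a + 1)"
  define S where "S = (\<lambda>(i, l). a * i + l) ` ({..k} \<times> {..k})"
  define D where "D = m * (N + 1) - 1"
  define C where "C = corners a m k"
  define R where "R = {t. fst t + snd t = D \<and> t \<notin> C + UNIV}"
  have cS: "card S = (k + 1)^2"
    using card_image[OF inj_on_two_digits[OF k]] by (simp add: S_def power2_eq_square)
  have S_le: "u \<le> N" if u: "u \<in> S" for u
  proof -
    obtain i l where "i \<le> k" "l \<le> k" "u = a * i + l" using u by (auto simp: S_def)
    then have "u \<le> a * k + k" by (auto intro!: add_mono)
    then show ?thesis by (simp add: N_def algebra_simps)
  qed
  have C_eq: "C = (\<lambda>u. (m * u, m * (N - u))) ` S"
  proof -
    have "a * (k - i) + (k - l) = N - (a * i + l)" if il: "i \<le> k" "l \<le> k" for i l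
    proof -
      obtain p q where pq: "k = i + p" "k = l + q" using il by (metis le_add_diff_inverse)
      then have "k - i = p" "k - l = q" by (metis add_diff_cancel_left')+
      moreover have "N = a * (i + p) + (l + q)"
        unfolding pq[symmetric] by (simp add: N_def algebra_simps)
      ultimately show ?thesis by (simp add: algebra_simps)
    qed
    then show ?thesis unfolding C_def corners_def S_def image_image
      by (intro image_cong) auto
  qed
  have finS: "finite S" by (simp add: S_def)
  have finC: "finite C" by (simp add: C_eq finS)
  have cC: "card C = (k + 1)^2"
  proof -
    have "inj_on (\<lambda>u. (m * u, m * (N - u))) S" using m by (auto intro!: inj_onI)
    then show ?thesis by (simp add: C_eq card_image cS)
  qed
  have mem: "(i, D - i) \<in> C + UNIV \<longleftrightarrow> i div m \<in> S" if i: "i < m * (N + 1)" for i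
  proof -
    have "(m * u \<le> i \<and> m * (N - u) \<le> D - i) \<longleftrightarrow> i div m = u" if u: "u \<in> S" for u
    proof -
      obtain v where v: "N = u + v" using S_le[OF u] le_Suc_ex by blast
      have "m * (N + 1) = m * u + m * v + m" by (simp add: v algebra_simps)
      \<comment> \<open>The \<open>- 1\<close> in \<open>D\<close> turns the condition on the second
        coordinate into \<open>i \<le> m * u + m - 1\<close>, the end of the block of
        \<open>u\<close>.\<close>
      then have "m * (N - u) \<le> D - i \<longleftrightarrow> i < m * u + m"
        using i m by (auto simp: D_def v)
      then have "(m * u \<le> i \<and> m * (N - u) \<le> D - i) \<longleftrightarrow> m * u \<le> i \<and> i < m * Suc u"
        by (simp add: add.commute)
      also have "\<dots> \<longleftrightarrow> i div m = u"
        using m div_nat_eqI[of m u i] dividend_less_times_div[of m i] by (auto simp: ac_simps)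
      finally show ?thesis .
    qed
    then show ?thesis unfolding mem_plus_UNIV_iff C_eq by auto
  qed
  have D: "i \<le> D \<longleftrightarrow> i < m * (N + 1)" for i
  proof -
    have "m * (N + 1) \<ge> 1" using m by simp
    then show ?thesis unfolding D_def by linarith
  qed
  have sub: "{i. i div m \<in> S} \<subseteq> {..<m * (N + 1)}"
  proof
    fix i assume "i \<in> {i. i div m \<in> S}"
    then have "i div m < N + 1" using S_le by fastforce
    then show "i \<in> {..<m * (N + 1)}" using m by (simp add: div_less_iff_less_mult mult.commute)
  qed
  have R_eq: "R = (\<lambda>i. (i, D - i)) ` ({..<m * (N + 1)} - {i. i div m \<in> S})"
  proof
    show "R \<subseteq> (\<lambda>i. (i, D - i)) ` ({..<m * (N + 1)} - {i. i div m \<in> S})"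
    proof
      fix t assume t: "t \<in> R"
      then have "t = (fst t, D - fst t)" "fst t < m * (N + 1)"
        using D[of "fst t"] by (auto simp: R_def prod_eq_iff)
      then show "t \<in> (\<lambda>i. (i, D - i)) ` ({..<m * (N + 1)} - {i. i div m \<in> S})"
        using t mem[of "fst t"] by (auto simp: R_def)
    qed
    show "(\<lambda>i. (i, D - i)) ` ({..<m * (N + 1)} - {i. i div m \<in> S}) \<subseteq> R"
    proof
      fix t assume "t \<in> (\<lambda>i. (i, D - i)) ` ({..<m * (N + 1)} - {i. i div m \<in> S})"
      then obtain i where i: "t = (i, D - i)" "i < m * (N + 1)" "i div m \<notin> S" by blast
      then have "fst t + snd t = D" using D[of i] by simp
      then show "t \<in> R" using mem[OF i(2)] i by (simp only: R_def mem_Collect_eq simp_thms)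
    qed
  qed
  have finR: "finite R" unfolding R_eq by (intro finite_imageI finite_Diff finite_lessThan)
  have "card R = card ({..<m * (N + 1)} - {i. i div m \<in> S})"
    unfolding R_eq by (rule card_image) (auto intro: inj_onI)
  also have "\<dots> = m * (N + 1) - m * (k + 1)^2"
    using card_Diff_subset[OF finite_subset[OF sub] sub] card_div_mem[OF m, of S] by (simp add: cS)
  finally have cR: "card R = m * (N + 1) - m * (k + 1)^2" .
  \<comment> \<open>This makes the truncated subtraction in \<open>cR\<close> exact.\<close>
  have "m * (k + 1)^2 \<le> m * (N + 1)"
    using card_mono[OF _ sub] card_div_mem[OF m, of S] by (simp add: cS)
  moreover have "C \<inter> R = {}" unfolding R_def using mem_plus_UNIV_self by blast
  moreover have gens: "pow_gens a m k = C \<union> R"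
    by (simp add: pow_gens_def C_def R_def D_def N_def)
  ultimately show "card (pow_gens a m k) + m * (k + 1)^2 = (k + 1)^2 + m * (k * (a + 1) + 1)"
    using card_Un_disjoint[OF finC finR] cC cR by (simp add: N_def)
  show "finite (pow_gens a m k)" by (simp add: gens finC finR)
qed

lemma min_gens_pow_I_am:
  assumes "m \<ge> 1" and "k < a"
  shows "min_gens (ideal_pow (I_am a m :: 'k::field poly2 set) k) + m * (k + 1)^2
    = (k + 1)^2 + m * (k * (a + 1) + 1)"
proof -
  have "ideal_pow (I_am a m :: 'k poly2 set) k = monomial_ideal (pow_gens a m k + UNIV)"
    using assms by (simp add: ideal_pow_I_am pow_gens_plus_UNIV)
  then have "min_gens (ideal_pow (I_am a m :: 'k poly2 set) k) = card (pow_gens a m k)"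
    using min_gens_monomial_ideal[OF card_pow_gens(1)[OF assms]] pow_gens_minimal[OF assms(1)] by metis
  then show ?thesis using card_pow_gens(2)[OF assms] by simp
qed

section \<open>Choice of the parameters\<close>

theorem corollary2p8:
  fixes k0 :: nat
  assumes "k0 > 1"
  shows "\<exists>a m :: nat. a \<ge> 3 \<and> m \<ge> 1 \<and>
    has_local_max_at (\<lambda>k. min_gens (ideal_pow (I_am a m :: 'k::field poly2 set) k)) k0"
proof -
  define j where "j = k0 - 1"
  then have j: "k0 = Suc j" "j \<ge> 1" using assms by simp_all
  \<comment> \<open>Over the integers, \<open>step\<close> below reads
    \<open>?f (k + 1) - ?f k = m * (a - 2 - 2 * k) + 2 * k + 3\<close>. This \<open>a\<close> gives
    \<open>m\<close> the factor \<open>1\<close> at \<open>k = j\<close> and \<open>-1\<close> at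
    \<open>k = j + 1\<close>; there \<open>m = 2 * j + 6\<close> just exceeds
    \<open>2 * j + 5\<close>.\<close>
  define a m where "a = 2 * j + 3" and "m = 2 * j + 6"
  let ?f = "\<lambda>k. min_gens (ideal_pow (I_am a m :: 'k poly2 set) k)"
  have f: "?f k + m * (k + 1)^2 = (k + 1)^2 + m * (k * (a + 1) + 1)" if "k < a" for k
    using that by (intro min_gens_pow_I_am) (simp_all add: m_def)
  have step: "?f (Suc k) + m * (2 * k + 3) = ?f k + m * (a + 1) + (2 * k + 3)" if "Suc k < a" for k
  proof -
    have sq: "(Suc k + 1)^2 = (k + 1)^2 + (2 * k + 3)"
      by (simp add: power2_eq_square)
    have "m * (Suc k + 1)^2 = m * (k + 1)^2 + m * (2 * k + 3)"
      by (simp only: sq distrib_left)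
    moreover have "m * (Suc k * (a + 1) + 1) = m * (k * (a + 1) + 1) + m * (a + 1)"
      by (simp add: distrib_left)
    ultimately show ?thesis using sq f[of k] f[of "Suc k"] that by linarith
  qed
  have "m * (a + 1) = m * (2 * j + 3) + m" "m * (2 * Suc j + 3) = m * (a + 1) + m"
    by (simp_all add: a_def distrib_left)
  \<comment> \<open>The rise is \<open>m + 2 * j + 3\<close>, the fall exactly \<open>1\<close>. All
    three arguments stay below \<open>a\<close>, as \<open>step\<close> requires.\<close>
  then have "?f j < ?f (Suc j)" "?f (Suc (Suc j)) < ?f (Suc j)"
    using step[of j] step[of "Suc j"] j(2) by (simp_all add: a_def m_def)
  then have "has_local_max_at ?f k0" using j by (simp add: has_local_max_at_def)
  moreover have "a \<ge> 3" "m \<ge> 1" by (simp_all add: a_def m_def)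
  ultimately show ?thesis by blast
qed

end
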